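(* For every $n\in\mathbb{N}$, $n\ge 1$, there exists a constant $B>0$ such that $$\bigg\|\sum_{k,l,m\in\mathbb{Z}}c_{k,l,m}L_{(2k,l,m)}\phi_n\bigg\|_{L^2(\mathbb{H})}^2\leq B\,\big\|\{c_{k,l,m}\}\big\|_{\ell^2(\mathbb{Z}^3)}^2\qquad\text{for all }\{c_{k,l,m}\}\in\ell^2(\mathbb{Z}^3),$$ where $\phi_n$ is the $n$-th order $B$-spline on the Heisenberg group $\mathbb{H}$ and $L_{(2k,l,m)}$ denotes left translation by $(2k,l,m)\in\mathbb{H}$.
   Context: The Heisenberg group $\mathbb{H}$ is $\mathbb{R}^3$ with the group law $(x,y,t)(x',y',t')=(x+x',\,y+y',\,t+t'+\tfrac12(x'y-y'x))$, so that $(x,y,t)^{-1}=(-x,-y,-t)$; Haar measure is Lebesgue measure $dx\,dy\,dt$ on $\mathbb{R}^3$, and $L^p(\mathbb{H})$ is taken with respect to it. For $f,g\in L^1(\mathbb{H})$, the convolution is $(f*g)(x,y,t)=\int_{\mathbb{H}}f\big((x,y,t)(u,v,s)^{-1}\big)g(u,v,s)\,du\,dv\,ds$. The $B$-splines on $\mathbb{H}$ are $\phi_1=\frac{1}{\sqrt2}\chi_{[0,2]\times[0,1]\times[0,1]}$ and $\phi_{n+1}=\phi_n*\phi_1$ for $n\ge1$ (so $\phi_n$ is the $n$-fold convolution of $\phi_1$). For $(u,v,s)\in\mathbb{H}$, the left translation operator is $L_{(u,v,s)}f(x,y,t)=f\big((u,v,s)^{-1}(x,y,t)\big)$. *)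

theory Defs
  imports "HOL-Analysis.Analysis"
begin

type_synonym heis = "real \<times> real \<times> real"

fun heis_mult :: "heis \<Rightarrow> heis \<Rightarrow> heis" where
  "heis_mult (x, y, t) (x', y', t') = (x + x', y + y', t + t' + (1/2) * (x' * y - y' * x))"

fun heis_inv :: "heis \<Rightarrow> heis" where
  "heis_inv (x, y, t) = (- x, - y, - t)"

(* Haar measure on the Heisenberg group is Lebesgue measure, here lborel on real * real * real. *)

definition heis_conv :: "(heis \<Rightarrow> complex) \<Rightarrow> (heis \<Rightarrow> complex) \<Rightarrow> heis \<Rightarrow> complex" where
  "heis_conv f g p = (LINT q|lborel. f (heis_mult p (heis_inv q)) * g q)"

definition left_trans :: "heis \<Rightarrow> (heis \<Rightarrow> complex) \<Rightarrow> heis \<Rightarrow> complex" where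
  "left_trans q f p = f (heis_mult (heis_inv q) p)"

definition bspline1 :: "heis \<Rightarrow> complex" where
  "bspline1 p = complex_of_real (1 / sqrt 2) * indicator ({0..2} \<times> {0..1} \<times> {0..1}) p"

(* The B-splines are indexed from 1; the value at index 0 is a dummy. *)
primrec bspline :: "nat \<Rightarrow> heis \<Rightarrow> complex" where
  "bspline 0 = (\<lambda>p. 0)"
| "bspline (Suc n) = (if n = 0 then bspline1 else heis_conv (bspline n) bspline1)"

(* Elements of L^2 are represented by square-integrable functions, not by classes modulo
   almost-everywhere equality. *)
definition L2_space :: "(heis \<Rightarrow> complex) set" where
  "L2_space = {f \<in> borel_measurable lborel. integrable lborel (\<lambda>p. (cmod (f p))\<^sup>2)}"

(* Meaningful on L2_space only: the integral of a non-integrable function is 0 by convention. *)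
definition L2_norm :: "(heis \<Rightarrow> complex) \<Rightarrow> real" where
  "L2_norm f = sqrt (LINT p|lborel. (cmod (f p))\<^sup>2)"

(* Unconditional convergence in the L^2 norm: the library's has_sum, with the L^2 seminorm in
   place of a topology. The limit F is determined up to almost-everywhere equality. *)
definition L2_has_sum :: "('i \<Rightarrow> heis \<Rightarrow> complex) \<Rightarrow> (heis \<Rightarrow> complex) \<Rightarrow> bool" where
  "L2_has_sum f F \<longleftrightarrow>
     (\<forall>i. f i \<in> L2_space) \<and> F \<in> L2_space \<and>
     ((\<lambda>A. L2_norm (\<lambda>p. (\<Sum>i\<in>A. f i p) - F p)) \<longlongrightarrow> 0) (finite_subsets_at_top UNIV)"

definition ell2 :: "('i \<Rightarrow> complex) set" where
  "ell2 = {c. (\<lambda>i. (cmod (c i))\<^sup>2) summable_on UNIV}"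

definition ell2_norm :: "('i \<Rightarrow> complex) \<Rightarrow> real" where
  "ell2_norm c = sqrt (\<Sum>\<^sub>\<infinity>i. (cmod (c i))\<^sup>2)"

end

theory Submission imports Defs begin

text \<open>
  Each \<open>\<phi>\<^sub>n\<close> is bounded, Borel and supported in a box, so at every point at most some fixed
  number \<open>N\<close> of the translates \<open>L(2k,l,m) \<phi>\<^sub>n\<close> is nonzero. The series is therefore a
  finite sum at each point, and by Cauchy-Schwarz the square of any of its subsums is at most \<open>N\<close>
  times the sum of the squares of its terms. Integrating gives \<open>B = N * \<parallel>\<phi>\<^sub>n\<parallel>\<^sup>2\<close>; the same
  estimate applied to the tails gives convergence.
\<close>

section \<open>Families with bounded overlap\<close>

lemma norm_sum_squared_le:
  fixes f :: "'i \<Rightarrow> 'a::real_normed_vector"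
  shows "(norm (\<Sum>i\<in>I. f i))\<^sup>2 \<le> card I * (\<Sum>i\<in>I. (norm (f i))\<^sup>2)"
proof -
  have "(norm (\<Sum>i\<in>I. f i))\<^sup>2 \<le> (\<Sum>i\<in>I. norm (f i))\<^sup>2"
    by (intro power_mono norm_sum) auto
  also have "\<dots> \<le> (\<Sum>i\<in>I. (norm (f i))\<^sup>2) * card I"
    by (rule sum_squared_le_sum_of_squares)
  finally show ?thesis by (simp add: mult.commute)
qed

text \<open>Links the counting measure, over which sums and integrals are exchanged, with the
  \<open>infsum\<close> in \<open>ell2_norm\<close>.\<close>

lemma nn_integral_count_space_eq_infsum:
  fixes f :: "'i \<Rightarrow> real"
  assumes "f summable_on A" "\<And>i. i \<in> A \<Longrightarrow> f i \<ge> 0"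
  shows "(\<integral>\<^sup>+i. ennreal (f i) \<partial>count_space A) = ennreal (infsum f A)"
proof -
  have "Infinite_Set_Sum.abs_summable_on f A"
    using assms summable_on_cong[of A "\<lambda>x. norm (f x)" f]
    by (simp flip: abs_summable_equivalent)
  then show ?thesis
    using assms by (simp add: nn_integral_conv_infsetsum infsetsum_infsum)
qed

text \<open>A finite bound on the nonnegative integral forces integrability, so the Lebesgue
  integral in \<open>L2_norm\<close> is a genuine value and not the default 0. The sign of
  \<open>C\<close> matters because \<open>ennreal\<close> sends negative numbers to 0.\<close>

lemma L2_norm_squared_le:
  assumes [measurable]: "f \<in> borel_measurable lborel"
    and "(\<integral>\<^sup>+p. ennreal ((cmod (f p))\<^sup>2) \<partial>lborel) \<le> ennreal C" and "C \<ge> 0"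
  shows "f \<in> L2_space" "(L2_norm f)\<^sup>2 \<le> C"
proof -
  have int: "integrable lborel (\<lambda>p. (cmod (f p))\<^sup>2)"
    using assms(2) by (intro integrableI_bounded) (auto intro: le_less_trans)
  then show "f \<in> L2_space" by (simp add: L2_space_def)
  have "ennreal (LINT p|lborel. (cmod (f p))\<^sup>2) \<le> ennreal C"
    using assms(2) int by (simp add: nn_integral_eq_integral)
  then show "(L2_norm f)\<^sup>2 \<le> C"
    using assms(3) by (simp add: L2_norm_def)
qed

text \<open>The index set of the sum varies with \<open>p\<close>, so this is not a fixed finite sum
  of measurable functions. It is an integral over the counting measure instead, and a parametrised
  integral of a jointly measurable function is measurable; countability of the index type gives the
  joint measurability.\<close>

lemma bounded_overlap_sum_measurable:
  fixes g :: "'i::countable \<Rightarrow> 'a \<Rightarrow> complex"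
  assumes g: "\<And>i. g i \<in> borel_measurable M"
    and fin: "\<And>p. finite {i. g i p \<noteq> 0}"
  shows "(\<lambda>p. \<Sum>i | g i p \<noteq> 0. g i p) \<in> borel_measurable M"
proof -
  interpret sigma_finite_measure "count_space (UNIV :: 'i set)"
    by (rule sigma_finite_measure_count_space)
  have "(\<lambda>(i, p). g i p) \<in> borel_measurable (count_space UNIV \<Otimes>\<^sub>M M)"
    using g by (intro measurable_pair_measure_countable1) auto
  then have "(\<lambda>(p, i). g i p) \<in> borel_measurable (M \<Otimes>\<^sub>M count_space UNIV)"
    by (subst measurable_pair_swap_iff) (simp add: case_prod_unfold)
  then have "(\<lambda>p. LINT i|count_space UNIV. g i p) \<in> borel_measurable M"
    by (rule borel_measurable_lebesgue_integral)
  then show ?thesis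
    using fin by (simp add: lebesgue_integral_count_space_finite_support)
qed

text \<open>The set \<open>I\<close> is kept arbitrary so that one estimate serves the whole series,
  its single terms and its tails.\<close>

lemma nn_integral_bounded_overlap_le:
  fixes f :: "'i::countable \<Rightarrow> 'a \<Rightarrow> complex"
  assumes [measurable]: "\<And>i. f i \<in> borel_measurable M"
    and fin: "\<And>p. finite {i. f i p \<noteq> 0}"
    and card: "\<And>p. card {i. f i p \<noteq> 0} \<le> N"
    and K: "\<And>i. (\<integral>\<^sup>+p. ennreal ((cmod (f i p))\<^sup>2) \<partial>M) \<le> ennreal K" "K \<ge> 0"
    and c: "(\<lambda>i. (cmod (c i))\<^sup>2) summable_on I"
  shows "(\<integral>\<^sup>+p. ennreal ((cmod (\<Sum>i | i \<in> I \<and> f i p \<noteq> 0. c i * f i p))\<^sup>2) \<partial>M)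
      \<le> ennreal (N * K * (\<Sum>\<^sub>\<infinity>i\<in>I. (cmod (c i))\<^sup>2))"
proof -
  let ?a = "\<lambda>i p. ennreal ((cmod (c i))\<^sup>2) * ennreal ((cmod (f i p))\<^sup>2)"
  have "ennreal ((cmod (\<Sum>i | i \<in> I \<and> f i p \<noteq> 0. c i * f i p))\<^sup>2)
      \<le> ennreal N * (\<integral>\<^sup>+i. ?a i p \<partial>count_space I)" for p
  proof -
    let ?S = "{i. i \<in> I \<and> f i p \<noteq> 0}"
    have sub: "?S \<subseteq> {i. f i p \<noteq> 0}" by auto
    have S: "finite ?S" "card ?S \<le> N"
      using finite_subset[OF sub fin] order_trans[OF card_mono[OF fin sub] card] by auto
    have "(cmod (\<Sum>i\<in>?S. c i * f i p))\<^sup>2 \<le> card ?S * (\<Sum>i\<in>?S. (cmod (c i * f i p))\<^sup>2)"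
      by (rule norm_sum_squared_le)
    also have "\<dots> \<le> N * (\<Sum>i\<in>?S. (cmod (c i))\<^sup>2 * (cmod (f i p))\<^sup>2)"
      using S by (intro mult_mono sum_nonneg) (auto simp: norm_mult power_mult_distrib)
    finally have "ennreal ((cmod (\<Sum>i\<in>?S. c i * f i p))\<^sup>2) \<le> ennreal N * (\<Sum>i\<in>?S. ?a i p)"
      by (simp add: ennreal_leI sum_nonneg flip: ennreal_mult)
    \<comment> \<open>The indices of \<open>I\<close> outside \<open>?S\<close> contribute 0, so the
      index set no longer depends on \<open>p\<close> and the two integrations can be
      exchanged.\<close>
    also have "(\<Sum>i\<in>?S. ?a i p) = (\<integral>\<^sup>+i. ?a i p \<partial>count_space I)"
      using S(1) by (intro nn_integral_count_space'[symmetric]) auto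
    finally show ?thesis .
  qed
  then have "(\<integral>\<^sup>+p. ennreal ((cmod (\<Sum>i | i \<in> I \<and> f i p \<noteq> 0. c i * f i p))\<^sup>2) \<partial>M)
      \<le> (\<integral>\<^sup>+p. ennreal N * (\<integral>\<^sup>+i. ?a i p \<partial>count_space I) \<partial>M)"
    by (intro nn_integral_mono)
  also have "\<dots> = (\<integral>\<^sup>+p. \<integral>\<^sup>+i. ennreal N * ?a i p \<partial>count_space I \<partial>M)"
    by (simp add: nn_integral_cmult)
  also have "\<dots> = (\<integral>\<^sup>+i. \<integral>\<^sup>+p. ennreal N * ?a i p \<partial>M \<partial>count_space I)"
    by (rule nn_integral_count_space_nn_integral) auto
  also have "\<dots> \<le> (\<integral>\<^sup>+i. ennreal (N * K) * ennreal ((cmod (c i))\<^sup>2) \<partial>count_space I)"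
  proof (rule nn_integral_mono)
    fix i
    have "(\<integral>\<^sup>+p. ennreal N * ?a i p \<partial>M)
        = ennreal N * (ennreal ((cmod (c i))\<^sup>2) * (\<integral>\<^sup>+p. ennreal ((cmod (f i p))\<^sup>2) \<partial>M))"
      by (simp add: nn_integral_cmult)
    also have "\<dots> \<le> ennreal N * (ennreal ((cmod (c i))\<^sup>2) * ennreal K)"
      by (intro mult_left_mono K) auto
    finally show "(\<integral>\<^sup>+p. ennreal N * ?a i p \<partial>M) \<le> ennreal (N * K) * ennreal ((cmod (c i))\<^sup>2)"
      using K(2) by (simp add: ennreal_mult ac_simps)
  qed
  also have "\<dots> = ennreal (N * K) * (\<integral>\<^sup>+i. ennreal ((cmod (c i))\<^sup>2) \<partial>count_space I)"
    by (simp add: nn_integral_cmult)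
  also have "\<dots> = ennreal (N * K * (\<Sum>\<^sub>\<infinity>i\<in>I. (cmod (c i))\<^sup>2))"
    using c K(2) by (simp add: nn_integral_count_space_eq_infsum ennreal_mult infsum_nonneg)
  finally show ?thesis .
qed

lemma L2_has_sum_bounded_overlap:
  fixes f :: "'i::countable \<Rightarrow> heis \<Rightarrow> complex"
  assumes f: "\<And>i. f i \<in> borel_measurable lborel"
    and fin: "\<And>p. finite {i. f i p \<noteq> 0}"
    and card: "\<And>p. card {i. f i p \<noteq> 0} \<le> N"
    and K: "\<And>i. (\<integral>\<^sup>+p. ennreal ((cmod (f i p))\<^sup>2) \<partial>lborel) \<le> ennreal K" "K \<ge> 0"
    and c: "c \<in> ell2"
  shows "\<exists>F. L2_has_sum (\<lambda>i p. c i * f i p) F \<and> (L2_norm F)\<^sup>2 \<le> N * K * (ell2_norm c)\<^sup>2"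
proof (intro exI conjI)
  \<comment> \<open>\<open>G UNIV\<close> is the limit of the series, \<open>G {i}\<close> its term
    at \<open>i\<close>, and \<open>G (- A)\<close> the remainder after a finite partial sum over
    \<open>A\<close>.\<close>
  define G where "G I p = (\<Sum>i | i \<in> I \<and> f i p \<noteq> 0. c i * f i p)" for I p
  have sm: "(\<lambda>i. (cmod (c i))\<^sup>2) summable_on I" for I
    using c by (auto simp: ell2_def intro: summable_on_subset_banach)
  have G_meas: "G I \<in> borel_measurable lborel" for I
  proof -
    \<comment> \<open>The factor \<open>of_bool\<close> encodes the restriction to \<open>I\<close>
      as a family over the whole type. Since \<open>c i\<close> may vanish, the support of
      \<open>?g\<close> can be smaller than the index set in \<open>G I\<close>; the extra terms are
      0.\<close>
    let ?g = "\<lambda>i p. of_bool (i \<in> I) * (c i * f i p)"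
    have "(\<lambda>p. \<Sum>i | ?g i p \<noteq> 0. ?g i p) \<in> borel_measurable lborel"
    proof (rule bounded_overlap_sum_measurable)
      show "?g i \<in> borel_measurable lborel" for i
        using f by (intro borel_measurable_times) auto
      show "finite {i. ?g i p \<noteq> 0}" for p
        by (rule finite_subset[OF _ fin[of p]]) auto
    qed
    also have "(\<lambda>p. \<Sum>i | ?g i p \<noteq> 0. ?g i p) = G I"
      unfolding G_def
      by (intro ext sum.mono_neutral_cong_left finite_subset[OF _ fin]) auto
    finally show ?thesis .
  qed
  have "(\<integral>\<^sup>+p. ennreal ((cmod (G I p))\<^sup>2) \<partial>lborel)
      \<le> ennreal (N * K * (\<Sum>\<^sub>\<infinity>i\<in>I. (cmod (c i))\<^sup>2))" for I
    unfolding G_def by (rule nn_integral_bounded_overlap_le[OF f fin card K sm])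
  note G = L2_norm_squared_le[OF G_meas this]
  have G_L2: "G I \<in> L2_space" and
    G_norm: "(L2_norm (G I))\<^sup>2 \<le> N * K * (\<Sum>\<^sub>\<infinity>i\<in>I. (cmod (c i))\<^sup>2)" for I
    using K(2) by (auto intro!: G mult_nonneg_nonneg infsum_nonneg)
  show "(L2_norm (G UNIV))\<^sup>2 \<le> N * K * (ell2_norm c)\<^sup>2"
    using G_norm[of UNIV] by (simp add: ell2_norm_def infsum_nonneg)
  have term_eq: "G {i} = (\<lambda>p. c i * f i p)" for i
  proof
    fix p
    have "{j. j \<in> {i} \<and> f j p \<noteq> 0} = (if f i p = 0 then {} else {i})" by auto
    then show "G {i} p = c i * f i p" by (simp add: G_def)
  qed
  have diff: "(\<lambda>p. (\<Sum>i\<in>A. c i * f i p) - G UNIV p) = (\<lambda>p. - G (- A) p)" if "finite A" for A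
  proof
    fix p
    have "G UNIV p = G A p + G (- A) p"
      unfolding G_def
      by (subst sum.union_disjoint[symmetric])
         (auto intro!: sum.cong finite_subset[OF _ fin[of p]])
    moreover have "(\<Sum>i\<in>A. c i * f i p) = G A p"
      unfolding G_def using that by (intro sum.mono_neutral_right) auto
    ultimately show "(\<Sum>i\<in>A. c i * f i p) - G UNIV p = - G (- A) p" by simp
  qed
  show "L2_has_sum (\<lambda>i p. c i * f i p) (G UNIV)"
    unfolding L2_has_sum_def
  proof (intro conjI allI G_L2)
    show "(\<lambda>p. c i * f i p) \<in> L2_space" for i
      using G_L2[of "{i}"] unfolding term_eq .
    let ?T = "\<Sum>\<^sub>\<infinity>i. (cmod (c i))\<^sup>2"
    have "((\<lambda>A. \<Sum>i\<in>A. (cmod (c i))\<^sup>2) \<longlongrightarrow> ?T) (finite_subsets_at_top UNIV)"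
      using has_sum_infsum[OF sm] by (simp add: has_sum_def)
    \<comment> \<open>Upper half of a squeeze: this bound depends only on the \<open>ell2\<close>
      mass of \<open>c\<close> outside \<open>A\<close>, which tends to 0.\<close>
    then have "((\<lambda>A. sqrt (N * K * (?T - (\<Sum>i\<in>A. (cmod (c i))\<^sup>2)))) \<longlongrightarrow> sqrt (N * K * (?T - ?T)))
        (finite_subsets_at_top UNIV)"
      by (intro tendsto_intros)
    moreover have "\<forall>\<^sub>F A in finite_subsets_at_top UNIV.
        L2_norm (\<lambda>p. (\<Sum>i\<in>A. c i * f i p) - G UNIV p) \<le> sqrt (N * K * (?T - (\<Sum>i\<in>A. (cmod (c i))\<^sup>2)))"
    proof (rule eventually_finite_subsets_at_top_weakI)
      fix A :: "'i set" assume A: "finite A"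
      have "L2_norm (\<lambda>p. (\<Sum>i\<in>A. c i * f i p) - G UNIV p) = L2_norm (G (- A))"
        unfolding diff[OF A] by (simp add: L2_norm_def)
      also have "\<dots> \<le> sqrt (N * K * (\<Sum>\<^sub>\<infinity>i\<in>-A. (cmod (c i))\<^sup>2))"
        by (rule real_le_rsqrt[OF G_norm])
      also have "(\<Sum>\<^sub>\<infinity>i\<in>-A. (cmod (c i))\<^sup>2) = ?T - (\<Sum>i\<in>A. (cmod (c i))\<^sup>2)"
        using infsum_Diff[OF sm sm, of A UNIV] A by (simp add: Compl_eq_Diff_UNIV)
      finally show "L2_norm (\<lambda>p. (\<Sum>i\<in>A. c i * f i p) - G UNIV p)
          \<le> sqrt (N * K * (?T - (\<Sum>i\<in>A. (cmod (c i))\<^sup>2)))" .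
    qed
    moreover have "\<forall>\<^sub>F A in finite_subsets_at_top UNIV.
        0 \<le> L2_norm (\<lambda>p. (\<Sum>i\<in>A. c i * f i p) - G UNIV p)"
      by (simp add: L2_norm_def)
    ultimately show "((\<lambda>A. L2_norm (\<lambda>p. (\<Sum>i\<in>A. c i * f i p) - G UNIV p)) \<longlongrightarrow> 0)
        (finite_subsets_at_top UNIV)"
      using real_tendsto_sandwich[OF _ _ tendsto_const] by fastforce
  qed
qed

section \<open>Left translations and B-splines\<close>

text \<open>The group law is polynomial, hence continuous; rewriting it with projections exposes
  this.\<close>

lemma heis_mult_measurable [measurable]:
  "(\<lambda>(p, q). heis_mult p q) \<in> borel \<Otimes>\<^sub>M borel \<rightarrow>\<^sub>M borel"
proof -
  have "(\<lambda>(p, q). heis_mult p q) = (\<lambda>(p, q). (fst p + fst q, fst (snd p) + fst (snd q),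
      snd (snd p) + snd (snd q) + (1/2) * (fst q * fst (snd p) - fst (snd q) * fst p)))"
    by auto
  also have "\<dots> \<in> borel_measurable borel"
    unfolding case_prod_unfold by (intro borel_measurable_continuous_onI continuous_intros)
  finally show ?thesis by (simp add: borel_prod)
qed

lemma heis_inv_eq_uminus: "heis_inv = uminus"
  by auto

text \<open>Left invariance of Haar measure. Left translation moves \<open>x\<close> and
  \<open>y\<close> by constants and \<open>t\<close> by an amount depending on \<open>x\<close> and
  \<open>y\<close> only, so integrating in \<open>t\<close> first reduces the claim to translation
  invariance on the real line.\<close>

lemma nn_integral_heis_left_translate:
  assumes [measurable]: "h \<in> borel_measurable borel"
  shows "(\<integral>\<^sup>+p. h (heis_mult q p) \<partial>lborel) = (\<integral>\<^sup>+p. h p \<partial>lborel)"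
proof -
  obtain a b c where q: "q = (a, b, c)" by (cases q)
  have shift: "(\<integral>\<^sup>+x. g (s + x) \<partial>lborel) = (\<integral>\<^sup>+x. g x \<partial>lborel)"
    if "g \<in> borel_measurable borel" for g :: "real \<Rightarrow> ennreal" and s
    using nn_integral_real_affine[OF that, of 1 s] by simp
  have iterated: "(\<integral>\<^sup>+p. g p \<partial>lborel) = (\<integral>\<^sup>+x. \<integral>\<^sup>+y. \<integral>\<^sup>+t. g (x, y, t) \<partial>lborel \<partial>lborel \<partial>lborel)"
    if [measurable]: "g \<in> borel_measurable borel" for g :: "heis \<Rightarrow> ennreal"
  proof -
    have "(\<integral>\<^sup>+p. g p \<partial>lborel) = (\<integral>\<^sup>+p. g p \<partial>(lborel \<Otimes>\<^sub>M lborel))"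
      by (simp add: lborel_prod)
    also have "\<dots> = (\<integral>\<^sup>+x. \<integral>\<^sup>+z. g (x, z) \<partial>lborel \<partial>lborel)"
      by (subst lborel.nn_integral_fst) (simp_all add: lborel_prod)
    also have "\<dots> = (\<integral>\<^sup>+x. \<integral>\<^sup>+z. g (x, z) \<partial>(lborel \<Otimes>\<^sub>M lborel) \<partial>lborel)"
      by (simp add: lborel_prod)
    also have "\<dots> = (\<integral>\<^sup>+x. \<integral>\<^sup>+y. \<integral>\<^sup>+t. g (x, y, t) \<partial>lborel \<partial>lborel \<partial>lborel)"
      by (subst lborel.nn_integral_fst) (simp_all add: lborel_prod)
    finally show ?thesis .
  qed
  have "(\<integral>\<^sup>+p. h (heis_mult q p) \<partial>lborel) = (\<integral>\<^sup>+x. \<integral>\<^sup>+y. \<integral>\<^sup>+t.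
      h (a + x, b + y, (c + (1/2) * (x * b - y * a)) + t) \<partial>lborel \<partial>lborel \<partial>lborel)"
    by (subst iterated) (simp_all add: q algebra_simps)
  \<comment> \<open>For fixed \<open>x\<close> and \<open>y\<close> the shear is a constant shift of
    \<open>t\<close>, absorbed by the innermost integral.\<close>
  also have "\<dots> = (\<integral>\<^sup>+x. \<integral>\<^sup>+y. \<integral>\<^sup>+t. h (a + x, b + y, t) \<partial>lborel \<partial>lborel \<partial>lborel)"
    by (subst shift) simp_all
  also have "\<dots> = (\<integral>\<^sup>+x. \<integral>\<^sup>+y. \<integral>\<^sup>+t. h (a + x, y, t) \<partial>lborel \<partial>lborel \<partial>lborel)"
    by (subst shift[where g = "\<lambda>y. \<integral>\<^sup>+t. h (a + x, y, t) \<partial>lborel" for x]) simp_all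
  also have "\<dots> = (\<integral>\<^sup>+x. \<integral>\<^sup>+y. \<integral>\<^sup>+t. h (x, y, t) \<partial>lborel \<partial>lborel \<partial>lborel)"
    by (subst shift[where g = "\<lambda>x. \<integral>\<^sup>+y. \<integral>\<^sup>+t. h (x, y, t) \<partial>lborel \<partial>lborel"]) simp_all
  also have "\<dots> = (\<integral>\<^sup>+p. h p \<partial>lborel)"
    by (subst iterated) simp_all
  finally show ?thesis .
qed

section \<open>Bounded functions supported in cubes\<close>

definition heis_cube :: "real \<Rightarrow> heis set" where
  "heis_cube r = {-r..r} \<times> {-r..r} \<times> {-r..r}"

lemma compact_heis_cube: "compact (heis_cube r)"
  unfolding heis_cube_def by (intro compact_Times compact_Icc)

text \<open>The indicator merges the sup bound and the support condition into one inequality. This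
  is the invariant that passes from \<open>bspline n\<close> to
  \<open>bspline (Suc n)\<close>.\<close>

definition bounded_in_cube :: "real \<Rightarrow> real \<Rightarrow> (heis \<Rightarrow> complex) \<Rightarrow> bool" where
  "bounded_in_cube M r g \<longleftrightarrow> g \<in> borel_measurable borel \<and>
     (\<forall>p. cmod (g p) \<le> M * indicator (heis_cube r) p)"

lemma bspline1_bounded_in_cube: "bounded_in_cube 1 2 bspline1"
proof -
  have "cmod (bspline1 p) \<le> 1 * indicator (heis_cube 2) p" for p
    by (cases p) (auto simp: bspline1_def heis_cube_def indicator_def norm_divide)
  moreover have "{0..2} \<times> {0..1} \<times> {0..1} \<in> sets (borel :: heis measure)"
    by (intro borel_closed closed_Times) auto
  then have "bspline1 \<in> borel_measurable borel"
    unfolding bspline1_def[abs_def] by (intro borel_measurable_times) auto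
  ultimately show ?thesis by (simp add: bounded_in_cube_def)
qed

text \<open>Where the integrand is nonzero, \<open>p\<close> is the product of a point of the cube
  of radius \<open>r\<close> and one of the cube of radius \<open>r'\<close>. Coordinates add up to
  at most \<open>r + r'\<close>, and the twist in the third coordinate adds at most
  \<open>r * r'\<close>.\<close>

lemma heis_conv_bounded_in_cube:
  assumes f: "bounded_in_cube M r f" and g: "bounded_in_cube M' r' g"
    and "r \<ge> 0" "r' \<ge> 0" "M \<ge> 0" "M' \<ge> 0"
  shows "bounded_in_cube (M * M' * measure lborel (heis_cube r')) (r + r' + r * r') (heis_conv f g)"
proof -
  have [measurable]: "f \<in> borel_measurable borel" "g \<in> borel_measurable borel"
    and f_le: "\<And>p. cmod (f p) \<le> M * indicator (heis_cube r) p"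
    and g_le: "\<And>p. cmod (g p) \<le> M' * indicator (heis_cube r') p"
    using f g by (auto simp: bounded_in_cube_def)
  let ?C = "heis_cube (r + r' + r * r')"
  have inv_m: "heis_inv \<in> borel \<rightarrow>\<^sub>M borel"
    unfolding heis_inv_eq_uminus by simp
  note [measurable] = inv_m
  have "heis_conv f g \<in> borel_measurable borel"
    unfolding heis_conv_def[abs_def] by measurable
  moreover have "cmod (heis_conv f g p)
      \<le> M * M' * measure lborel (heis_cube r') * indicator ?C p" for p
  proof -
    have supp: "indicator (heis_cube r) (heis_mult p (heis_inv q)) * indicator (heis_cube r') q
        \<le> (indicator ?C p * indicator (heis_cube r') q :: real)" for q
    proof -
      obtain x y t where p: "p = (x, y, t)" by (cases p)
      obtain u v s where q: "q = (u, v, s)" by (cases q)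
      have "p \<in> ?C" if "heis_mult p (heis_inv q) \<in> heis_cube r" "q \<in> heis_cube r'"
      proof -
        have 1: "\<bar>x - u\<bar> \<le> r" "\<bar>y - v\<bar> \<le> r" "\<bar>t - s + (1/2) * (v * x - u * y)\<bar> \<le> r"
          "\<bar>u\<bar> \<le> r'" "\<bar>v\<bar> \<le> r'" "\<bar>s\<bar> \<le> r'"
          using that by (auto simp: p q heis_cube_def)
        \<comment> \<open>The products \<open>u * v\<close> cancel, so
          \<open>v * x - u * y = A - B\<close>; each of \<open>A\<close> and \<open>B\<close> is a
          product of quantities bounded by \<open>r\<close> and \<open>r'\<close>.\<close>
        define A B where "A = v * (x - u)" and "B = u * (y - v)"
        have 2: "\<bar>A\<bar> \<le> r * r'" "\<bar>B\<bar> \<le> r * r'"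
          using mult_mono[OF 1(1) 1(5)] mult_mono[OF 1(2) 1(4)] \<open>r \<ge> 0\<close>
          by (simp_all add: A_def B_def abs_mult mult.commute)
        have "\<bar>t - s + (A - B) / 2\<bar> \<le> r"
          using 1(3) by (simp add: A_def B_def algebra_simps diff_divide_distrib)
        moreover have "0 \<le> r * r'" using \<open>r \<ge> 0\<close> \<open>r' \<ge> 0\<close> by simp
        ultimately have "\<bar>x\<bar> \<le> r + r' + r * r'" "\<bar>y\<bar> \<le> r + r' + r * r'"
          "\<bar>t\<bar> \<le> r + r' + r * r'"
          using 1(1,2,4,5,6) 2 by (simp_all only: abs_le_iff) (simp_all add: field_simps)
        then show ?thesis by (simp add: p heis_cube_def abs_le_iff)
      qed
      then show ?thesis by (auto simp: indicator_def)
    qed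
    have bound: "cmod (f (heis_mult p (heis_inv q)) * g q)
        \<le> M * M' * indicator ?C p * indicator (heis_cube r') q" for q
    proof -
      have "cmod (f (heis_mult p (heis_inv q)) * g q)
          \<le> (M * indicator (heis_cube r) (heis_mult p (heis_inv q)))
             * (M' * indicator (heis_cube r') q)"
        unfolding norm_mult using assms by (intro mult_mono f_le g_le) auto
      also have "\<dots> \<le> M * M' * (indicator ?C p * indicator (heis_cube r') q)"
        using mult_left_mono[OF supp[of q], of "M * M'"] assms by (simp add: ac_simps)
      finally show ?thesis by (simp add: ac_simps)
    qed
    \<comment> \<open>The finite volume of the cube makes the majorant integrable, so its integral
      is not a default value.\<close>
    have int: "integrable lborel (indicator (heis_cube r') :: heis \<Rightarrow> real)"
      using emeasure_compact_finite[OF compact_heis_cube[of r']] compact_heis_cube[of r']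
      by (simp add: borel_compact less_top)
    have "cmod (heis_conv f g p) \<le> (LINT q|lborel. cmod (f (heis_mult p (heis_inv q)) * g q))"
      unfolding heis_conv_def by (rule integral_norm_bound)
    also have "\<dots> \<le> (LINT q|lborel. M * M' * indicator ?C p * indicator (heis_cube r') q)"
      using int bound assms by (intro integral_mono') auto
    also have "\<dots> = M * M' * measure lborel (heis_cube r') * indicator ?C p"
      by simp
    finally show ?thesis .
  qed
  ultimately show ?thesis by (simp add: bounded_in_cube_def)
qed

lemma bspline_bounded_in_cube:
  assumes "n \<ge> 1"
  shows "\<exists>M r. M \<ge> 0 \<and> r \<ge> 0 \<and> bounded_in_cube M r (bspline n)"
  using assms
\<comment> \<open>The induction starts at 1, the value at 0 being a dummy; in the step
  \<open>n\<close> is at least 1, which selects the convolution branch of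
  \<open>bspline\<close>.\<close>
proof (induction n rule: dec_induct)
  case base
  then show ?case using bspline1_bounded_in_cube by (intro exI[of _ 1] exI[of _ 2]) auto
next
  case (step n)
  then obtain M r where "M \<ge> 0" "r \<ge> 0" "bounded_in_cube M r (bspline n)" by blast
  from heis_conv_bounded_in_cube[OF this(3) bspline1_bounded_in_cube] this(1,2) step.hyps
  show ?case
    by (intro exI[of _ "M * 1 * measure lborel (heis_cube 2)"] exI[of _ "r + 2 + r * 2"]) auto
qed

section \<open>Counting lattice translates\<close>

text \<open>A closed interval of length \<open>2 * R\<close> holds at most \<open>2 * R + 1\<close>
  integers wherever its centre lies. This uniformity in \<open>a\<close> makes the overlap bound
  independent of the point.\<close>

lemma card_int_near_le:
  fixes a :: real and R :: nat
  shows "finite {m::int. \<bar>a - m\<bar> \<le> R}" "card {m::int. \<bar>a - m\<bar> \<le> R} \<le> 2 * R + 1"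
proof -
  have eq: "{m::int. \<bar>a - m\<bar> \<le> R} = {\<lceil>a - R\<rceil>..\<lfloor>a + R\<rfloor>}"
    unfolding set_eq_iff mem_Collect_eq atLeastAtMost_iff ceiling_le_iff le_floor_iff
    by (safe; linarith)
  show "finite {m::int. \<bar>a - m\<bar> \<le> R}" unfolding eq by simp
  have "\<lfloor>a + R\<rfloor> - \<lceil>a - R\<rceil> \<le> 2 * int R" by linarith
  then show "card {m::int. \<bar>a - m\<bar> \<le> R} \<le> 2 * R + 1" unfolding eq by simp
qed

text \<open>Only the sizes of the fibres are bounded uniformly; the fibres may move with
  \<open>x\<close>, as the range of \<open>m\<close> does with \<open>k\<close> and
  \<open>l\<close>.\<close>

lemma card_Sigma_le:
  assumes "finite A" "card A \<le> a" "\<And>x. x \<in> A \<Longrightarrow> finite (B x)" "\<And>x. x \<in> A \<Longrightarrow> card (B x) \<le> b"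
  shows "finite (Sigma A B)" "card (Sigma A B) \<le> a * b"
proof -
  show "finite (Sigma A B)" using assms by (intro finite_SigmaI)
  have "card (Sigma A B) = (\<Sum>x\<in>A. card (B x))" using assms by (simp add: card_SigmaI)
  also have "\<dots> \<le> card A * b" using sum_bounded_above[of A "\<lambda>x. card (B x)" b] assms by simp
  also have "\<dots> \<le> a * b" using assms by simp
  finally show "card (Sigma A B) \<le> a * b" .
qed

text \<open>The shear in the third coordinate depends on \<open>(k, l)\<close> only, so for each such pair the
  admissible \<open>m\<close> still lie in an interval of fixed length.\<close>

lemma card_lattice_translates_in_cube_le:
  fixes p :: heis and R :: nat
  defines "S \<equiv> {(k::int, l::int, m::int).
      heis_mult (heis_inv (2 * real_of_int k, real_of_int l, real_of_int m)) p \<in> heis_cube R}"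
  shows "finite S" "card S \<le> (2 * R + 1) ^ 3"
proof -
  obtain x y t where p: "p = (x, y, t)" by (cases p)
  \<comment> \<open>Membership in the cube gives \<open>R / 2\<close> as the bound for
    \<open>x / 2 - k\<close>; it is widened to \<open>R\<close> so that the same count serves all
    three coordinates.\<close>
  define T where "T = Sigma {k::int. \<bar>x / 2 - k\<bar> \<le> R} (\<lambda>k. Sigma {l::int. \<bar>y - l\<bar> \<le> R}
      (\<lambda>l. {m::int. \<bar>t + (1/2) * (2 * k * y - x * l) - m\<bar> \<le> R}))"
  have "S \<subseteq> T"
    unfolding S_def T_def
    by (auto simp: p heis_cube_def abs_le_iff algebra_simps)
  have T: "finite T" "card T \<le> (2 * R + 1) * ((2 * R + 1) * (2 * R + 1))"
  proof -
    note near = card_int_near_le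
    note inner = card_Sigma_le[OF near near]
    show "finite T" "card T \<le> (2 * R + 1) * ((2 * R + 1) * (2 * R + 1))"
      unfolding T_def by (rule card_Sigma_le[OF near inner])+
  qed
  show "finite S" using \<open>S \<subseteq> T\<close> T(1) by (rule finite_subset)
  show "card S \<le> (2 * R + 1) ^ 3"
    using card_mono[OF T(1) \<open>S \<subseteq> T\<close>] T(2) by (simp only: power3_eq_cube ac_simps)
qed

theorem proposition2p2:
  fixes n :: nat
  assumes "n \<ge> 1"
  shows "\<exists>B::real. B > 0 \<and>
    (\<forall>c \<in> (ell2 :: (int \<times> int \<times> int \<Rightarrow> complex) set).
       \<exists>F. L2_has_sum
             (\<lambda>(k, l, m) p. c (k, l, m) *
                left_trans (2 * real_of_int k, real_of_int l, real_of_int m) (bspline n) p) F \<and>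
           (L2_norm F)\<^sup>2 \<le> B * (ell2_norm c)\<^sup>2)"
proof -
  obtain M r where M: "M \<ge> 0" "bounded_in_cube M r (bspline n)"
    using bspline_bounded_in_cube[OF assms] by blast
  \<comment> \<open>The radius is rounded up because the lattice count takes a natural
    number.\<close>
  define R where "R = nat \<lceil>r\<rceil>"
  define \<tau> where "\<tau> = (\<lambda>(k, l, m). (2 * real_of_int k, real_of_int l, real_of_int m))"
  define f where "f i = left_trans (\<tau> i) (bspline n)" for i
  \<comment> \<open>\<open>K\<close> bounds the squared \<open>L2_norm\<close> of
    \<open>bspline n\<close>, and by left invariance that of each translate; \<open>N\<close> bounds
    the number of translates that are nonzero at a point.\<close>
  define K where "K = M\<^sup>2 * measure lborel (heis_cube r)"
  define N where "N = (2 * R + 1) ^ 3"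
  have [measurable]: "bspline n \<in> borel_measurable borel"
    and le: "\<And>p. cmod (bspline n p) \<le> M * indicator (heis_cube r) p"
    using M by (auto simp: bounded_in_cube_def)
  have [measurable]: "f i \<in> borel_measurable lborel" for i
    unfolding f_def left_trans_def[abs_def] by simp
  have supp: "{i. f i p \<noteq> 0} \<subseteq> {(k, l, m).
      heis_mult (heis_inv (2 * real_of_int k, real_of_int l, real_of_int m)) p \<in> heis_cube R}" for p
  proof -
    have "heis_cube r \<subseteq> heis_cube R"
      unfolding heis_cube_def R_def by (intro Sigma_mono) auto
    moreover have "q \<in> heis_cube r" if "bspline n q \<noteq> 0" for q
      using le[of q] that by (cases "q \<in> heis_cube r") auto
    ultimately have "heis_mult (heis_inv (\<tau> i)) p \<in> heis_cube R" if "f i p \<noteq> 0" for i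
      using that unfolding f_def left_trans_def by blast
    then show ?thesis by (fastforce simp: \<tau>_def)
  qed
  have K: "(\<integral>\<^sup>+p. ennreal ((cmod (f i p))\<^sup>2) \<partial>lborel) \<le> ennreal K" for i
  proof -
    have "(\<integral>\<^sup>+p. ennreal ((cmod (f i p))\<^sup>2) \<partial>lborel) = (\<integral>\<^sup>+p. ennreal ((cmod (bspline n p))\<^sup>2) \<partial>lborel)"
      unfolding f_def left_trans_def by (rule nn_integral_heis_left_translate) simp
    also have "\<dots> \<le> (\<integral>\<^sup>+p. ennreal (M\<^sup>2) * indicator (heis_cube r) p \<partial>lborel)"
    proof (rule nn_integral_mono)
      show "ennreal ((cmod (bspline n p))\<^sup>2) \<le> ennreal (M\<^sup>2) * indicator (heis_cube r) p" for p
        using power_mono[OF le[of p], of 2]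
        by (auto simp: indicator_def intro!: ennreal_leI split: if_splits)
    qed
    also have "\<dots> = ennreal K"
      using emeasure_compact_finite[OF compact_heis_cube[of r]] compact_heis_cube[of r]
      by (simp add: K_def nn_integral_cmult_indicator borel_compact ennreal_mult
          emeasure_eq_ennreal_measure less_top)
    finally show ?thesis .
  qed
  have K0: "K \<ge> 0" by (simp add: K_def)
  show ?thesis
  \<comment> \<open>Adding 1 gives strict positivity, as \<open>K\<close> is only known to be
    nonnegative.\<close>
  proof (intro exI[of _ "N * K + 1"] conjI ballI)
    show "N * K + 1 > 0" using K0 by (simp add: add_nonneg_pos)
    fix c :: "int \<times> int \<times> int \<Rightarrow> complex" assume "c \<in> ell2"
    then have "\<exists>F. L2_has_sum (\<lambda>i p. c i * f i p) F \<and> (L2_norm F)\<^sup>2 \<le> N * K * (ell2_norm c)\<^sup>2"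
      using finite_subset[OF supp card_lattice_translates_in_cube_le(1)]
        order_trans[OF card_mono[OF card_lattice_translates_in_cube_le(1) supp]
          card_lattice_translates_in_cube_le(2)]
      by (intro L2_has_sum_bounded_overlap K K0) (auto simp: N_def)
    moreover have "N * K * (ell2_norm c)\<^sup>2 \<le> (N * K + 1) * (ell2_norm c)\<^sup>2"
      by (intro mult_right_mono) auto
    moreover have "(\<lambda>i p. c i * f i p) = (\<lambda>(k, l, m) p. c (k, l, m) *
        left_trans (2 * real_of_int k, real_of_int l, real_of_int m) (bspline n) p)"
      by (auto simp: f_def \<tau>_def)
    ultimately show "\<exists>F. L2_has_sum (\<lambda>(k, l, m) p. c (k, l, m) *
        left_trans (2 * real_of_int k, real_of_int l, real_of_int m) (bspline n) p) F \<and>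
        (L2_norm F)\<^sup>2 \<le> (N * K + 1) * (ell2_norm c)\<^sup>2"
      by force
  qed
qed

end
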